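(* Let $0\le q_1<q_0\le 1$ and let $\{G_n\}_n$ be a $\phi$-expander family of regular graphs. Then there exists a constant $\gamma\equiv\gamma(q_0,q_1,\phi)\in(0,1)$ (depending only on $q_0,q_1,\phi$) such that, under the biased voter rule on $G_n$, if the initial number $A(0)$ of agents with opinion $1$ satisfies $A(0)=\Omega(\log n)$, then with probability at least $1-O\left(\frac{\log n}{n^{\gamma}}\right)$ consensus is achieved on the superior opinion $1$ (i.e. all agents have opinion $1$) in $$O\left(\frac{\log n}{\log\left(1+\frac{q_0-q_1}{2}\phi\right)}\right)+O\left(\frac{\log n}{\log\left(\frac{1}{1-(q_0-q_1)\phi}\right)}\right)$$ time steps.
   Context: For each $n$, $G_n=(V_n,E_n)$ is an undirected $d_n$-regular graph with $|V_n|=n$; $N_u$ is the set of neighbours of $u$. For $S\subseteq V_n$, $E(S,S^c)$ is the number of edges with one endpoint in $S$ and the other in $S^c=V_n\setminus S$. The conductance is $\phi_n=\min_{\emptyset\ne S\subseteq V_n,\,|S|\le n/2}\frac{E(S,S^c)}{d_n|S|}$. The sequence $\{G_n\}_n$ is a $\phi$-expander family of regular graphs if $\phi_n\ge\phi$ for all $n$, where $\phi>0$ is a constant independent of $n$. Biased voter rule: each agent (vertex) $u$ has an opinion $X_u^n(t)\in\{0,1\}$ at each time $t=0,1,2,\dots$. In each step all agents update synchronously and, given the current state, independently: an agent $u$ with opinion $i$ keeps opinion $i$ with probability $1-q_i$, and with probability $q_i$ it samples $N\in N_u$ uniformly at random and sets $X_u^n(t+1)=X_N^n(t)$. The process $\mathbf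 X^n(t)=(X_u^n(t))_{u\in V_n}$ is a Markov chain on $\{0,1\}^n$. Opinion $1$ is called the superior opinion because $q_1<q_0$. Asymptotic notation refers to $n\to\infty$.
   Formalization: One γ(q0,q1,φ) is proved for A(0) ≥ log n; if only A(0) ≥ c log n with c<1, the exponent may be smaller and depend on c too, since for q1>0 no single γ serves every Ω-constant (on complete graphs all ones may die in one step). Constants in O may depend on q0,q1,φ. *)

theory Defs
  imports "HOL-Probability.Probability" "HOL-Library.Landau_Symbols" "Graph_Theory.Pair_Digraph"
begin

section \<open>Regular expander families\<close>

text \<open>
  A finite simple undirected graph is a \<open>pair_graph\<close>: a finite, loop-free digraph whose set of arcs
  is symmetric, so that an undirected edge \<open>uv\<close> is the pair of arcs \<open>(u, v)\<close>, \<open>(v, u)\<close>.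
\<close>

definition neighbours :: "'a pair_pre_digraph \<Rightarrow> 'a \<Rightarrow> 'a set" where
  "neighbours G u = {v. (u, v) \<in> parcs G}"

definition regular_graph :: "nat \<Rightarrow> 'a pair_pre_digraph \<Rightarrow> bool" where
  "regular_graph d G \<longleftrightarrow> pair_graph G \<and> (\<forall>u \<in> pverts G. card (neighbours G u) = d)"

text \<open>
  Each undirected edge between \<open>S\<close> and its complement has exactly one of its two arcs pointing
  out of \<open>S\<close>, so every such edge is counted once.
\<close>

definition cut_edges :: "'a pair_pre_digraph \<Rightarrow> 'a set \<Rightarrow> nat" where
  "cut_edges G S = card {(u, v) \<in> parcs G. u \<in> S \<and> v \<in> pverts G - S}"

text \<open>The minimum is over a nonempty set if and only if \<open>G\<close> has at least two vertices.\<close>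

definition conductance :: "nat \<Rightarrow> 'a pair_pre_digraph \<Rightarrow> real" where
  "conductance d G =
     (MIN S \<in> {S. S \<subseteq> pverts G \<and> S \<noteq> {} \<and> real (card S) \<le> real (card (pverts G)) / 2}.
        real (cut_edges G S) / (real d * real (card S)))"

definition expander_family :: "real \<Rightarrow> (nat \<Rightarrow> 'a pair_pre_digraph) \<Rightarrow> bool" where
  "expander_family \<phi> G \<longleftrightarrow> 0 < \<phi> \<and>
     (\<exists>d :: nat \<Rightarrow> nat.
        (\<forall>n. regular_graph (d n) (G n) \<and> card (pverts (G n)) = n) \<and>
        (\<forall>n\<ge>2. \<phi> \<le> conductance (d n) (G n)))"

section \<open>The biased voter rule\<close>

text \<open>
  A state assigns to each vertex its opinion, with \<open>True\<close> for opinion 1 and \<open>False\<close> for opinion 0.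
  The values of a state outside \<open>pverts G\<close> are irrelevant; after a step they are \<open>False\<close>.
\<close>

definition voter_update ::
    "real \<Rightarrow> real \<Rightarrow> 'a pair_pre_digraph \<Rightarrow> ('a \<Rightarrow> bool) \<Rightarrow> 'a \<Rightarrow> bool pmf" where
  "voter_update q0 q1 G X u =
     bind_pmf (bernoulli_pmf (if X u then q1 else q0))
       (\<lambda>sample. if sample then map_pmf X (pmf_of_set (neighbours G u)) else return_pmf (X u))"

definition voter_step ::
    "real \<Rightarrow> real \<Rightarrow> 'a pair_pre_digraph \<Rightarrow> ('a \<Rightarrow> bool) \<Rightarrow> ('a \<Rightarrow> bool) pmf" where
  "voter_step q0 q1 G X = Pi_pmf (pverts G) False (voter_update q0 q1 G X)"

text \<open>The law of the trajectory \<open>[X(0), \<dots>, X(T)]\<close> of the chain started from \<open>X(0) = X\<close>.\<close>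

primrec voter_path ::
    "real \<Rightarrow> real \<Rightarrow> 'a pair_pre_digraph \<Rightarrow> ('a \<Rightarrow> bool) \<Rightarrow> nat \<Rightarrow> ('a \<Rightarrow> bool) list pmf" where
  "voter_path q0 q1 G X 0 = return_pmf [X]"
| "voter_path q0 q1 G X (Suc T) =
     bind_pmf (voter_step q0 q1 G X) (\<lambda>Y. map_pmf ((#) X) (voter_path q0 q1 G Y T))"

definition num_ones :: "'a pair_pre_digraph \<Rightarrow> ('a \<Rightarrow> bool) \<Rightarrow> nat" where
  "num_ones G X = card {u \<in> pverts G. X u}"

definition superior_consensus :: "'a pair_pre_digraph \<Rightarrow> ('a \<Rightarrow> bool) \<Rightarrow> bool" where
  "superior_consensus G X \<longleftrightarrow> (\<forall>u \<in> pverts G. X u)"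

end

theory Submission
  imports Defs "HOL-Real_Asymp.Real_Asymp"
begin

text \<open>
  Let \<open>A\<close> be the number of vertices with opinion 1 and \<open>B = n - A\<close>. If \<open>c\<close> is the number of edges
  between the two opinions divided by the degree, then in one step the expected number of switches
  from 0 to 1 is \<open>q0 c\<close> and from 1 to 0 it is \<open>q1 c\<close>, and expansion gives \<open>c \<ge> \<phi> min A B\<close>.
  So \<open>A\<close> has a positive drift, proportional to the smaller class. The proof measures this drift by
  three functions of the state.

  \<^item> The exponential \<open>r ^ A\<close> with \<open>q1 / q0 < r < 1\<close> satisfies
    \<open>E (r ^ A') \<le> r ^ A exp (- \<kappa> c)\<close> for some \<open>\<kappa> > 0\<close>
    (lemma \<open>step_expectation_power_num_ones\<close>). It is a supermartingale, so from \<open>A \<ge> c0 ln n\<close> the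
    chain falls back to a bounded \<open>A\<close> at a given time with probability
    \<open>O(n powr (- c0 ln (1 / r)))\<close>. This dominates the error, and
    summation over the \<open>O(ln n)\<close> steps gives the logarithm in the numerator.

  \<^item> The reciprocal \<open>1 / (A + 1)\<close> contracts by a constant factor while \<open>K \<le> A \<le> n / 2\<close>. Its
    expectation is controlled by the same exponential moment
    (lemma \<open>reciprocal_num_ones_decay\<close>).

  \<^item> The number \<open>B\<close> contracts by a constant factor while \<open>A \<ge> n / 4\<close>, since its drift is linear
    (lemma \<open>step_expectation_num_zeros\<close>).

  The last two are glued to one potential, avoiding a separate treatment of two phases and of the
  times between them: after adding to \<open>B\<close> the term \<open>n r powr (A - n / 3)\<close>, which is at most
  \<open>n\<close> for \<open>A \<ge> n / 2\<close> and exponentially large for \<open>A \<le> n / 4\<close>, and multiplying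
  \<open>1 / (A + 1)\<close> by \<open>3 n\<^sup>2\<close>, the minimum of the two is attained by a piece that
  contracts, whenever \<open>A \<ge> K\<close> and \<open>n\<close> is large. This potential is at least 1 before
  consensus and at most \<open>3 n\<^sup>2\<close> at the start, so after a suitable multiple of \<open>ln n\<close> steps its contribution to the
  failure probability is \<open>O(1 / n)\<close> (lemmas \<open>failure_le_potential\<close>, \<open>failure_bound\<close>). Since
  \<open>\<gamma> = ln (1 / r)\<close> may be taken below 1, this is absorbed in the error from falling back.
\<close>

section \<open>Cuts in regular graphs\<close>

lemma regular_graph_finite:
  assumes "regular_graph d G"
  shows "finite (pverts G)"
proof -
  interpret pair_graph G using assms by (simp add: regular_graph_def)
  show ?thesis by simp
qed

lemma neighbours_subset:
  assumes "regular_graph d G"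
  shows "neighbours G u \<subseteq> pverts G"
proof -
  interpret pair_graph G using assms by (simp add: regular_graph_def)
  show ?thesis by (auto simp: neighbours_def dest: in_arcsD2)
qed

lemma cut_edges_eq_sum:
  assumes "regular_graph d G" and "S \<subseteq> pverts G"
  shows "cut_edges G S = (\<Sum>u\<in>S. card (neighbours G u - S))"
proof -
  have fin: "finite (pverts G)" "finite S"
    using regular_graph_finite[OF assms(1)] assms(2) finite_subset by auto
  have nb: "neighbours G u \<subseteq> pverts G" for u
    using neighbours_subset[OF assms(1)] .
  have "{(u, v) \<in> parcs G. u \<in> S \<and> v \<in> pverts G - S} = (SIGMA u:S. neighbours G u - S)"
    using nb by (auto simp: neighbours_def)
  then show ?thesis
    unfolding cut_edges_def using fin nb
    by (simp add: card_SigmaI finite_subset[OF _ fin(1)] finite_Diff)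
qed

text \<open>
  Reversing arcs matches the two cuts, since the arc set is symmetric.
\<close>

lemma cut_edges_compl:
  assumes "regular_graph d G" and "S \<subseteq> pverts G"
  shows "cut_edges G (pverts G - S) = cut_edges G S"
proof -
  interpret pair_graph G using assms by (simp add: regular_graph_def)
  have "bij_betw prod.swap {(u, v) \<in> parcs G. u \<in> pverts G - S \<and> v \<in> pverts G - (pverts G - S)}
          {(u, v) \<in> parcs G. u \<in> S \<and> v \<in> pverts G - S}"
    by (rule bij_betwI[where g = prod.swap])
      (use assms(2) in \<open>auto dest: arcs_symmetric\<close>)
  then show ?thesis
    unfolding cut_edges_def by (rule bij_betw_same_card)
qed

lemma conductance_le:
  assumes "regular_graph d G" and "S \<subseteq> pverts G" "S \<noteq> {}"
    and "real (card S) \<le> real (card (pverts G)) / 2"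
  shows "conductance d G \<le> real (cut_edges G S) / (real d * real (card S))"
  unfolding conductance_def
  by (rule Min_le) (use assms regular_graph_finite[OF assms(1)] in auto)

text \<open>
  In the empty graph every quotient in the definition of the conductance has denominator 0,
  so the conductance would be 0.
\<close>

lemma degree_pos_of_conductance_pos:
  assumes "regular_graph d G" and "2 \<le> card (pverts G)" and "0 < conductance d G"
  shows "0 < d"
proof -
  obtain v where "v \<in> pverts G" using assms(2) by fastforce
  then have "conductance d G \<le> real (cut_edges G {v}) / (real d * real (card {v}))"
    using assms(1,2) by (intro conductance_le) auto
  then show ?thesis using assms(3) by (cases d) auto
qed

text \<open>
  The conductance only tests sets of at most half the vertices. A larger set is handled through its
  complement, which has the same cut; hence the minimum of the two sizes.
\<close>

lemma expansion_of_cuts: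
  assumes reg: "regular_graph d G" and "2 \<le> card (pverts G)" and "0 < \<phi>" "\<phi> \<le> conductance d G"
    and S: "S \<subseteq> pverts G"
  shows "\<phi> * min (real (card S)) (real (card (pverts G - S))) \<le> real (cut_edges G S) / real d"
proof -
  have d: "0 < d" using degree_pos_of_conductance_pos assms by fastforce
  have fin: "finite (pverts G)" using regular_graph_finite[OF reg] by simp
  have small: "\<phi> * real (card S') \<le> real (cut_edges G S') / real d"
    if "S' \<subseteq> pverts G" "real (card S') \<le> real (card (pverts G)) / 2" for S'
  proof (cases "S' = {}")
    case False
    then have "0 < card S'" using that(1) fin by (simp add: card_gt_0_iff finite_subset)
    have "\<phi> \<le> real (cut_edges G S') / (real d * real (card S'))"
      using conductance_le[OF reg that(1) False that(2)] assms(4) by simp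
    then show ?thesis using d \<open>0 < card S'\<close> by (simp add: field_simps)
  qed simp
  have card: "real (card S) + real (card (pverts G - S)) = real (card (pverts G))"
    using S fin by (simp add: card_Diff_subset finite_subset card_mono flip: of_nat_add)
  show ?thesis
  proof (cases "card S \<le> card (pverts G - S)")
    case True
    then show ?thesis using small[OF S] card by (simp add: min_def)
  next
    case False
    then show ?thesis
      using small[of "pverts G - S"] card cut_edges_compl[OF reg S] by (simp add: min_def)
  qed
qed

section \<open>One step of the biased voter rule\<close>

locale biased_voter =
  fixes q0 q1 :: real and G :: "'a pair_pre_digraph" and d :: nat
  assumes regular: "regular_graph d G" and degree_pos: "0 < d"
    and q1_nonneg: "0 \<le> q1" and q1_le_q0: "q1 \<le> q0" and q0_le_1: "q0 \<le> 1"
begin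

abbreviation num_zeros :: "('a \<Rightarrow> bool) \<Rightarrow> nat" where
  "num_zeros X \<equiv> card {u \<in> pverts G. \<not> X u}"

abbreviation step_expectation :: "('a \<Rightarrow> bool) \<Rightarrow> (('a \<Rightarrow> bool) \<Rightarrow> real) \<Rightarrow> real" where
  "step_expectation X \<equiv> measure_pmf.expectation (voter_step q0 q1 G X)"

definition disagreement_prob :: "('a \<Rightarrow> bool) \<Rightarrow> 'a \<Rightarrow> real" where
  "disagreement_prob X u = real (card {v \<in> neighbours G u. X v \<noteq> X u}) / real d"

text \<open>
  The cut between the two opinions in units of \<open>d\<close>. It is the sum of the disagreement
  probabilities over the vertices of opinion 1, and also over those of opinion 0, so the expected
  numbers of switches to 1 and to 0 in a step are \<open>q0\<close> and \<open>q1\<close> times this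
  number.
\<close>

definition cut_weight :: "('a \<Rightarrow> bool) \<Rightarrow> real" where
  "cut_weight X = real (cut_edges G {u \<in> pverts G. X u}) / real d"

lemma finite_verts: "finite (pverts G)"
  using regular_graph_finite[OF regular] by simp

lemma sum_disagreement_prob_ones: "(\<Sum>u | u \<in> pverts G \<and> X u. disagreement_prob X u) = cut_weight X"
proof -
  let ?S = "{u \<in> pverts G. X u}"
  have "{v \<in> neighbours G u. X v \<noteq> X u} = neighbours G u - ?S" if "u \<in> ?S" for u
    using that neighbours_subset[OF regular] by auto
  then show ?thesis
    using cut_edges_eq_sum[OF regular, of ?S]
    by (simp add: cut_weight_def disagreement_prob_def sum_divide_distrib)
qed

lemma sum_disagreement_prob_zeros: "(\<Sum>u | u \<in> pverts G \<and> \<not> X u. disagreement_prob X u) = cut_weight X"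
proof -
  let ?S = "{u \<in> pverts G. X u}" and ?Z = "{u \<in> pverts G. \<not> X u}"
  have "{v \<in> neighbours G u. X v \<noteq> X u} = neighbours G u - ?Z" if "u \<in> ?Z" for u
    using that neighbours_subset[OF regular] by auto
  moreover have "?Z = pverts G - ?S" by auto
  ultimately show ?thesis
    using cut_edges_eq_sum[OF regular, of ?Z] cut_edges_compl[OF regular, of ?S]
    by (simp add: cut_weight_def disagreement_prob_def sum_divide_distrib)
qed

lemma num_ones_plus_num_zeros: "num_ones G X + num_zeros X = card (pverts G)"
proof -
  have "card (pverts G) = card ({u \<in> pverts G. X u} \<union> {u \<in> pverts G. \<not> X u})"
    by (rule arg_cong[where f = card]) auto
  then show ?thesis
    unfolding num_ones_def using finite_verts by (subst (asm) card_Un_disjoint) auto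
qed

lemma superior_consensus_iff: "superior_consensus G X \<longleftrightarrow> num_zeros X = 0"
  using finite_verts by (auto simp: superior_consensus_def)

text \<open>
  A vertex switches exactly when it decides to sample and meets a disagreeing neighbour.
\<close>

lemma expectation_voter_update:
  fixes f :: "bool \<Rightarrow> real"
  assumes "u \<in> pverts G"
  shows "measure_pmf.expectation (voter_update q0 q1 G X u) f =
    f (X u) + (if X u then q1 else q0) * disagreement_prob X u * (f (\<not> X u) - f (X u))"
proof -
  let ?q = "if X u then q1 else q0"
  have q: "?q \<in> {0..1}" using q1_nonneg q1_le_q0 q0_le_1 by auto
  have cd: "card (neighbours G u) = d" using regular assms by (simp add: regular_graph_def)
  then have nb: "finite (neighbours G u)" "neighbours G u \<noteq> {}"
    using degree_pos card_gt_0_iff by fastforce+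
  have "pmf (map_pmf X (pmf_of_set (neighbours G u))) (\<not> X u) = disagreement_prob X u"
  proof -
    have "neighbours G u \<inter> X -` {\<not> X u} = {v \<in> neighbours G u. X v \<noteq> X u}" by auto
    then show ?thesis
      using nb cd by (simp add: pmf_map measure_pmf_of_set disagreement_prob_def)
  qed
  then have flip: "pmf (voter_update q0 q1 G X u) (\<not> X u) = ?q * disagreement_prob X u"
    unfolding voter_update_def using q by (simp add: pmf_bind)
  have two: "(\<Sum>b\<in>{X u, \<not> X u}. h b) = h (X u) + h (\<not> X u)" for h :: "bool \<Rightarrow> real"
    by (cases "X u") auto
  have "(\<Sum>b\<in>{X u, \<not> X u}. pmf (voter_update q0 q1 G X u) b) = 1"
    by (rule sum_pmf_eq_1) auto
  then have keep: "pmf (voter_update q0 q1 G X u) (X u) = 1 - ?q * disagreement_prob X u"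
    unfolding two flip by (simp only: eq_diff_eq)
  have "measure_pmf.expectation (voter_update q0 q1 G X u) f =
      (\<Sum>b\<in>{X u, \<not> X u}. pmf (voter_update q0 q1 G X u) b *\<^sub>R f b)"
    by (rule integral_measure_pmf) auto
  also have "\<dots> = f (X u) + ?q * disagreement_prob X u * (f (\<not> X u) - f (X u))"
    unfolding two flip keep by (simp add: algebra_simps)
  finally show ?thesis .
qed

text \<open>
  Integrability is never an issue: a step can reach only finitely many states.
\<close>

lemma integrable_voter_step:
  fixes f :: "('a \<Rightarrow> bool) \<Rightarrow> real"
  shows "integrable (measure_pmf (voter_step q0 q1 G X)) f"
proof (rule integrable_measure_pmf_finite)
  have "finite (PiE_dflt (pverts G) False (\<lambda>u. set_pmf (voter_update q0 q1 G X u)))"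
    by (intro finite_PiE_dflt finite_verts) (rule finite_subset[OF subset_UNIV], simp)
  then show "finite (set_pmf (voter_step q0 q1 G X))"
    unfolding voter_step_def by (simp add: set_Pi_pmf finite_verts comp_def)
qed

lemma step_expectation_mono:
  assumes "\<And>Y. f Y \<le> g Y"
  shows "step_expectation X f \<le> step_expectation X g"
  by (intro integral_mono integrable_voter_step) (simp_all add: assms)

lemma step_expectation_add:
  "step_expectation X (\<lambda>Y. f Y + g Y) = step_expectation X f + step_expectation X g"
  by (intro Bochner_Integration.integral_add integrable_voter_step)

lemma step_expectation_num_zeros:
  "step_expectation X (\<lambda>Y. real (num_zeros Y)) = real (num_zeros X) - (q0 - q1) * cut_weight X"
proof -
  let ?O = "{u \<in> pverts G. X u}" and ?Z = "{u \<in> pverts G. \<not> X u}"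
  have card: "real (num_zeros Y) = (\<Sum>u\<in>pverts G. of_bool (\<not> Y u))" for Y
    using finite_verts by (simp add: sum.If_cases Int_def)
  have split: "(\<Sum>u\<in>pverts G. h u) = (\<Sum>u\<in>?O. h u) + (\<Sum>u\<in>?Z. h u)" for h :: "'a \<Rightarrow> real"
  proof -
    have "pverts G = ?O \<union> ?Z" by auto
    moreover have "sum h (?O \<union> ?Z) = sum h ?O + sum h ?Z"
      using finite_verts by (intro sum.union_disjoint) auto
    ultimately show ?thesis by simp
  qed
  have "step_expectation X (\<lambda>Y. real (num_zeros Y)) =
      (\<Sum>u\<in>pverts G. step_expectation X (\<lambda>Y. of_bool (\<not> Y u)))"
    unfolding card by (intro Bochner_Integration.integral_sum integrable_voter_step)
  also have "\<dots> = (\<Sum>u\<in>pverts G. measure_pmf.expectation (voter_update q0 q1 G X u) (\<lambda>b. of_bool (\<not> b)))"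
  proof (rule sum.cong[OF refl])
    fix u assume "u \<in> pverts G"
    then have "map_pmf (\<lambda>Y. Y u) (voter_step q0 q1 G X) = voter_update q0 q1 G X u"
      unfolding voter_step_def by (simp add: Pi_pmf_component finite_verts)
    then show "step_expectation X (\<lambda>Y. of_bool (\<not> Y u)) =
        measure_pmf.expectation (voter_update q0 q1 G X u) (\<lambda>b. of_bool (\<not> b))"
      using integral_map_pmf[of "\<lambda>Y. Y u" "voter_step q0 q1 G X" "\<lambda>b. of_bool (\<not> b) :: real"]
      by (simp only:)
  qed
  also have "\<dots> = (\<Sum>u\<in>?O. q1 * disagreement_prob X u) + (\<Sum>u\<in>?Z. 1 - q0 * disagreement_prob X u)"
    unfolding split by (intro arg_cong2[where f = "(+)"] sum.cong refl)
      (simp_all add: expectation_voter_update)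
  also have "\<dots> = real (num_zeros X) - (q0 - q1) * cut_weight X"
    by (simp add: sum_subtractf sum_disagreement_prob_ones sum_disagreement_prob_zeros algebra_simps
        flip: sum_distrib_left)
  finally show ?thesis .
qed

text \<open>
  The exponential moment factorises because the updates are independent. A vertex of opinion 0
  with disagreement probability \<open>p\<close> contributes the factor \<open>1 - q0 p (1 - r)\<close>, one of opinion 1
  the factor \<open>r (1 + q1 p (1 / r - 1))\<close>. After \<open>1 + x \<le> exp x\<close> only the two sums of
  disagreement probabilities remain, and they coincide. The rate
  \<open>(1 - r) (q0 - q1 / r)\<close> is positive when \<open>q1 / q0 < r < 1\<close>.
\<close>

lemma step_expectation_power_num_ones:
  assumes r: "0 < r" "r < 1"
  shows "step_expectation X (\<lambda>Y. r ^ num_ones G Y) \<le>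
    r ^ num_ones G X * exp (- ((1 - r) * (q0 - q1 / r)) * cut_weight X)"
proof -
  let ?O = "{u \<in> pverts G. X u}" and ?Z = "{u \<in> pverts G. \<not> X u}"
  define w where "w b = (if b then r else 1)" for b
  define e where "e u = (if X u then q1 * disagreement_prob X u * (1 / r - 1) else - q0 * disagreement_prob X u * (1 - r))" for u
  have power: "r ^ num_ones G Y = (\<Prod>u\<in>pverts G. w (Y u))" for Y
    unfolding num_ones_def w_def using finite_verts by (simp add: prod.If_cases Int_def)
  have "step_expectation X (\<lambda>Y. r ^ num_ones G Y) =
      (\<Prod>u\<in>pverts G. measure_pmf.expectation (voter_update q0 q1 G X u) w)"
    unfolding power voter_step_def
  proof (rule expectation_prod_Pi_pmf[OF finite_verts])
    show "integrable (measure_pmf (voter_update q0 q1 G X u)) w" for u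
      by (rule integrable_measure_pmf_finite) (rule finite_subset[OF subset_UNIV], simp)
  qed (use r in \<open>auto simp: w_def\<close>)
  also have "\<dots> \<le> (\<Prod>u\<in>pverts G. w (X u) * exp (e u))"
  proof (rule prod_mono, safe)
    fix u assume u: "u \<in> pverts G"
    show "0 \<le> measure_pmf.expectation (voter_update q0 q1 G X u) w"
      using r by (intro Bochner_Integration.integral_nonneg) (auto simp: w_def)
    have "measure_pmf.expectation (voter_update q0 q1 G X u) w = w (X u) * (1 + e u)"
      using r by (simp add: expectation_voter_update[OF u] w_def e_def field_simps)
    also have "\<dots> \<le> w (X u) * exp (e u)"
      using r exp_ge_add_one_self by (intro mult_left_mono) (auto simp: w_def)
    finally show "measure_pmf.expectation (voter_update q0 q1 G X u) w \<le> w (X u) * exp (e u)" .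
  qed
  also have "\<dots> = r ^ num_ones G X * exp (\<Sum>u\<in>pverts G. e u)"
    by (simp add: prod.distrib power exp_sum finite_verts)
  also have "(\<Sum>u\<in>pverts G. e u) = (\<Sum>u\<in>?O. q1 * disagreement_prob X u * (1 / r - 1)) + (\<Sum>u\<in>?Z. - q0 * disagreement_prob X u * (1 - r))"
    unfolding e_def using finite_verts by (simp add: sum.If_cases Int_def)
  also have "\<dots> = q1 * cut_weight X * (1 / r - 1) + - q0 * cut_weight X * (1 - r)"
    by (simp only: sum_disagreement_prob_ones sum_disagreement_prob_zeros flip: sum_distrib_left sum_distrib_right)
  also have "\<dots> = - ((1 - r) * (q0 - q1 / r)) * cut_weight X"
    using r by (simp add: field_simps)
  finally show ?thesis .
qed

end

section \<open>From potential functions to consensus\<close>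

context biased_voter
begin

text \<open>
  Consensus is searched along the whole trajectory, which makes the recursion below stop at
  the first consensus state.
\<close>

definition failure :: "('a \<Rightarrow> bool) \<Rightarrow> nat \<Rightarrow> real" where
  "failure X T = measure_pmf.prob (voter_path q0 q1 G X T) {path. \<forall>Y\<in>set path. \<not> superior_consensus G Y}"

lemma failure_eq_pmf:
  "failure X T = pmf (map_pmf (\<lambda>path. \<forall>Y\<in>set path. \<not> superior_consensus G Y) (voter_path q0 q1 G X T)) True"
  by (simp add: failure_def pmf_map vimage_def)

lemma failure_le_1: "failure X T \<le> 1"
  by (simp add: failure_def)

lemma failure_0: "failure X 0 = of_bool (\<not> superior_consensus G X)"
  by (simp add: failure_eq_pmf)

lemma failure_Suc:
  "failure X (Suc T) = (if superior_consensus G X then 0 else step_expectation X (\<lambda>Y. failure Y T))"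
  by (simp add: failure_eq_pmf map_bind_pmf pmf.map_comp comp_def pmf_bind)

lemma failure_eq_1_minus:
  "failure X T = 1 - measure_pmf.prob (voter_path q0 q1 G X T)
     {path. \<exists>Y\<in>set path. superior_consensus G Y}"
proof -
  have "{path. \<forall>Y\<in>set path. \<not> superior_consensus G Y} = - {path. \<exists>Y\<in>set path. superior_consensus G Y}"
    by auto
  then show ?thesis
    unfolding failure_def
    using measure_pmf.prob_compl[of "{path. \<exists>Y\<in>set path. superior_consensus G Y}" "voter_path q0 q1 G X T"]
    by (simp add: Compl_eq_Diff_UNIV)
qed

text \<open>
  Two supersolutions are combined. The potential \<open>H\<close> dominates the indicator of failure and
  shrinks by the factor \<open>l\<close> in each step, except from states where \<open>R\<close> has reached 1. At such a
  state the failure probability is bounded by 1, hence by \<open>R\<close>; since \<open>R\<close> does not increase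
  in expectation, paying \<open>R X\<close> once per step covers all visits.
\<close>

lemma failure_le_potential:
  fixes H R :: "('a \<Rightarrow> bool) \<Rightarrow> real" and l :: real
  assumes "0 \<le> l" and H_nonneg: "\<And>X. 0 \<le> H X" and R_nonneg: "\<And>X. 0 \<le> R X"
    and H_ge_1: "\<And>X. \<not> superior_consensus G X \<Longrightarrow> 1 \<le> H X"
    and contract: "\<And>X. \<not> superior_consensus G X \<Longrightarrow> R X < 1 \<Longrightarrow> step_expectation X H \<le> l * H X"
    and super: "\<And>X. step_expectation X R \<le> R X"
  shows "failure X T \<le> l ^ T * H X + real T * R X"
proof (induction T arbitrary: X)
  case 0
  show ?case using H_ge_1 H_nonneg by (simp add: failure_0)
next
  case (Suc T)
  consider "superior_consensus G X" | "1 \<le> R X" | "\<not> superior_consensus G X" "R X < 1" by linarith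
  then show ?case
  proof cases
    case 1
    then show ?thesis using \<open>0 \<le> l\<close> H_nonneg R_nonneg by (simp add: failure_Suc)
  next
    case 2
    have "failure X (Suc T) \<le> 1 * R X" using failure_le_1[of X "Suc T"] 2 by simp
    also have "\<dots> \<le> real (Suc T) * R X" using R_nonneg by (intro mult_right_mono) auto
    also have "\<dots> \<le> l ^ Suc T * H X + real (Suc T) * R X" using \<open>0 \<le> l\<close> H_nonneg by simp
    finally show ?thesis .
  next
    case 3
    have "failure X (Suc T) = step_expectation X (\<lambda>Y. failure Y T)"
      using 3 by (simp add: failure_Suc)
    also have "\<dots> \<le> step_expectation X (\<lambda>Y. l ^ T * H Y + real T * R Y)"
      by (rule step_expectation_mono) (rule Suc.IH)
    also have "\<dots> = l ^ T * step_expectation X H + real T * step_expectation X R"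
      by (simp add: step_expectation_add)
    also have "\<dots> \<le> l ^ T * (l * H X) + real T * R X"
      using \<open>0 \<le> l\<close> contract[OF 3] super by (intro add_mono mult_left_mono) auto
    also have "\<dots> \<le> l ^ Suc T * H X + real (Suc T) * R X"
      using R_nonneg[of X] by (simp add: algebra_simps)
    finally show ?thesis .
  qed
qed

end

section \<open>Potentials for the biased voter rule on an expander\<close>

text \<open>
  Growth by the factor \<open>1 + \<epsilon>\<close> contracts the reciprocal of \<open>a + 1\<close> once \<open>a\<close> is
  large, and an exponentially unlikely exception does not spoil this.
\<close>

lemma reciprocal_gain_absorbs_exponential:
  fixes \<epsilon> \<beta> :: real
  assumes "0 < \<epsilon>" "0 < \<beta>"
  shows "\<exists>l\<in>{0<..<1}. \<exists>K. \<forall>a\<ge>K. 1 / ((1 + \<epsilon>) * real a + 1) + exp (- \<beta> * real a) \<le> l / (real a + 1)"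
proof -
  define l where "l = (1 / (1 + \<epsilon>) + 1) / 2"
  have l: "0 < l" "l < 1" "1 / (1 + \<epsilon>) < l" using assms by (auto simp: l_def field_simps add_pos_pos)
  have "((\<lambda>a::nat. (real a + 1) / ((1 + \<epsilon>) * real a + 1)) \<longlongrightarrow> 1 / (1 + \<epsilon>)) at_top"
    using assms by (real_asymp simp: inverse_eq_divide)
  moreover have "((\<lambda>a::nat. (real a + 1) * exp (- \<beta> * real a)) \<longlongrightarrow> 0) at_top"
    using assms by real_asymp
  ultimately have "((\<lambda>a::nat. (real a + 1) / ((1 + \<epsilon>) * real a + 1) + (real a + 1) * exp (- \<beta> * real a))
      \<longlongrightarrow> 1 / (1 + \<epsilon>) + 0) at_top"
    by (rule tendsto_add)
  then have "eventually (\<lambda>a::nat. (real a + 1) / ((1 + \<epsilon>) * real a + 1) + (real a + 1) * exp (- \<beta> * real a) < l) at_top"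
    using l(3) by (intro order_tendstoD(2)) auto
  then obtain K where "\<And>a::nat. a \<ge> K \<Longrightarrow>
      (real a + 1) / ((1 + \<epsilon>) * real a + 1) + (real a + 1) * exp (- \<beta> * real a) < l"
    by (auto simp: eventually_at_top_linorder)
  then have "1 / ((1 + \<epsilon>) * real a + 1) + exp (- \<beta> * real a) \<le> l / (real a + 1)" if "a \<ge> K" for a
    using that by (subst pos_le_divide_eq) (auto simp: algebra_simps intro: less_imp_le)
  then show ?thesis using l(1,2) by (intro bexI[of _ l] exI[of _ K]) auto
qed

text \<open>
  The base \<open>r\<close> of the exponential moment lies strictly between \<open>q1 / q0\<close> and 1,
  where its decay rate is positive.
\<close>

locale expanding_voter = biased_voter +
  fixes \<phi> r :: real
  assumes expansion_pos: "0 < \<phi>"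
    and expansion: "\<phi> * min (real (num_ones G X)) (real (num_zeros X)) \<le> cut_weight X"
    and r_pos: "0 < r" and r_less_1: "r < 1" and bias: "q1 < q0 * r"
begin

definition decay :: real where
  "decay = (1 - r) * (q0 - q1 / r)"

lemma decay_pos: "0 < decay"
  unfolding decay_def using r_pos r_less_1 bias by (intro mult_pos_pos) (simp_all add: field_simps)

lemma strict_bias: "q1 < q0"
proof -
  have "0 \<le> q0" using q1_nonneg q1_le_q0 by simp
  then have "q0 * r \<le> q0 * 1" using r_less_1 by (intro mult_left_mono) auto
  then show ?thesis using bias by simp
qed

lemma power_num_ones_decay:
  "step_expectation X (\<lambda>Y. r ^ num_ones G Y) \<le>
    r ^ num_ones G X * exp (- decay * \<phi> * min (real (num_ones G X)) (real (num_zeros X)))"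
proof -
  have "- decay * cut_weight X \<le> - decay * \<phi> * min (real (num_ones G X)) (real (num_zeros X))"
    using mult_left_mono[OF expansion less_imp_le[OF decay_pos]] by (simp add: mult.assoc)
  then show ?thesis
    using step_expectation_power_num_ones[OF r_pos r_less_1, of X] r_pos
    unfolding decay_def[symmetric]
    by (elim order_trans) (simp add: mult_left_mono)
qed

lemma power_num_ones_superharmonic:
  "step_expectation X (\<lambda>Y. r ^ num_ones G Y) \<le> r ^ num_ones G X"
proof -
  have "exp (- decay * \<phi> * min (real (num_ones G X)) (real (num_zeros X))) \<le> 1"
    using decay_pos expansion_pos by simp
  then have "r ^ num_ones G X * exp (- decay * \<phi> * min (real (num_ones G X)) (real (num_zeros X)))
      \<le> r ^ num_ones G X * 1"
    using r_pos by (intro mult_left_mono) auto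
  then show ?thesis using power_num_ones_decay[of X] by simp
qed

text \<open>
  The new number \<open>A'\<close> of ones rarely stays below \<open>(1 + \<epsilon>) a\<close>. Instead of splitting
  into events, the reciprocal is bounded pointwise by \<open>1 / ((1 + \<epsilon>) a + 1)\<close> plus
  \<open>r powr (A' - (1 + \<epsilon>) a)\<close>, as the latter is at least 1 when \<open>A'\<close> is too small. The value
  of \<open>\<epsilon>\<close> is chosen such that the shift by \<open>\<epsilon> a\<close> uses up half of the exponential decay.
\<close>

lemma reciprocal_num_ones_decay:
  assumes "num_ones G X \<le> num_zeros X"
  defines "a \<equiv> real (num_ones G X)" and "\<epsilon> \<equiv> decay * \<phi> / (2 * ln (1 / r))"
  shows "step_expectation X (\<lambda>Y. 1 / (real (num_ones G Y) + 1)) \<le>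
    1 / ((1 + \<epsilon>) * a + 1) + exp (- (decay * \<phi> / 2) * a)"
proof -
  define M where "M = r powr (- ((1 + \<epsilon>) * a))"
  have \<theta>: "0 < ln (1 / r)" using r_pos r_less_1 by simp
  have \<epsilon>: "0 < \<epsilon>" using \<theta> decay_pos expansion_pos by (simp add: \<epsilon>_def)
  have pointwise: "1 / (real (num_ones G Y) + 1) \<le> 1 / ((1 + \<epsilon>) * a + 1) + M * r ^ num_ones G Y" for Y
  proof (cases "(1 + \<epsilon>) * a \<le> real (num_ones G Y)")
    case True
    then have "1 / (real (num_ones G Y) + 1) \<le> 1 / ((1 + \<epsilon>) * a + 1)"
      using \<epsilon> by (intro divide_left_mono) (auto simp: a_def add_nonneg_pos)
    moreover have "0 \<le> M * r ^ num_ones G Y" using r_pos by (simp add: M_def)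
    ultimately show ?thesis by linarith
  next
    case False
    have "M * r ^ num_ones G Y = r powr (real (num_ones G Y) - (1 + \<epsilon>) * a)"
      using r_pos by (simp add: M_def powr_realpow[symmetric] powr_add[symmetric])
    also have "\<dots> \<ge> r powr 0"
      using False r_pos r_less_1 by (intro powr_mono') auto
    finally have "1 \<le> M * r ^ num_ones G Y" using r_pos by simp
    moreover have "1 / (real (num_ones G Y) + 1) \<le> 1" by simp
    moreover have "0 \<le> 1 / ((1 + \<epsilon>) * a + 1)" using \<epsilon> by (simp add: a_def)
    ultimately show ?thesis by linarith
  qed
  have "step_expectation X (\<lambda>Y. 1 / (real (num_ones G Y) + 1)) \<le>
      step_expectation X (\<lambda>Y. 1 / ((1 + \<epsilon>) * a + 1) + M * r ^ num_ones G Y)"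
    by (rule step_expectation_mono) (rule pointwise)
  also have "\<dots> = 1 / ((1 + \<epsilon>) * a + 1) + M * step_expectation X (\<lambda>Y. r ^ num_ones G Y)"
    by (simp add: step_expectation_add)
  also have "M * step_expectation X (\<lambda>Y. r ^ num_ones G Y) \<le> M * (r ^ num_ones G X * exp (- decay * \<phi> * a))"
    using power_num_ones_decay[of X] assms(1) by (intro mult_left_mono) (auto simp: M_def a_def)
  also have "\<dots> = exp (- (decay * \<phi> / 2) * a)"
  proof -
    have "M * r ^ num_ones G X = r powr (- \<epsilon> * a)"
      using r_pos by (simp add: M_def a_def powr_realpow[symmetric] powr_add[symmetric] algebra_simps)
    also have "\<dots> = exp (decay * \<phi> / 2 * a)"
      using \<theta> r_pos by (simp add: powr_def \<epsilon>_def ln_div field_simps)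
    finally have "M * (r ^ num_ones G X * exp (- decay * \<phi> * a)) = exp (decay * \<phi> / 2 * a) * exp (- decay * \<phi> * a)"
      by (simp add: mult.assoc[symmetric])
    also have "\<dots> = exp (- (decay * \<phi> / 2) * a)"
      by (simp add: exp_add[symmetric] algebra_simps)
    finally show ?thesis .
  qed
  finally show ?thesis by simp
qed

text \<open>
  Near consensus the number of zeros contracts by itself. The second summand is negligible there,
  but in large graphs it makes this potential exceed the early one when fewer than a quarter of
  the vertices have opinion 1.
\<close>

definition late_potential :: "('a \<Rightarrow> bool) \<Rightarrow> real" where
  "late_potential X = real (num_zeros X) + real (card (pverts G)) * r powr (real (num_ones G X) - real (card (pverts G)) / 3)"

text \<open>
  While at most half of the vertices, but not too few, have opinion 1, their number typically grows
  by a constant factor, so its reciprocal contracts. The factor \<open>3 n\<^sup>2\<close> lifts it above the late potential once opinion 1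
  has the majority.
\<close>

definition early_potential :: "('a \<Rightarrow> bool) \<Rightarrow> real" where
  "early_potential X = 3 * (real (card (pverts G)))\<^sup>2 / (real (num_ones G X) + 1)"

lemma early_potential_contracts:
  assumes "2 * num_ones G X \<le> card (pverts G)"
    and "1 / ((1 + decay * \<phi> / (2 * ln (1 / r))) * real (num_ones G X) + 1)
      + exp (- (decay * \<phi> / 2) * real (num_ones G X)) \<le> l / (real (num_ones G X) + 1)"
  shows "step_expectation X early_potential \<le> l * early_potential X"
proof -
  have "num_ones G X \<le> num_zeros X" using assms(1) num_ones_plus_num_zeros[of X] by linarith
  then have *: "step_expectation X (\<lambda>Y. 1 / (real (num_ones G Y) + 1)) \<le> l / (real (num_ones G X) + 1)"
    using reciprocal_num_ones_decay[of X] assms(2) by linarith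
  have "step_expectation X early_potential =
      3 * (real (card (pverts G)))\<^sup>2 * step_expectation X (\<lambda>Y. 1 / (real (num_ones G Y) + 1))"
    by (subst integral_mult_right_zero[symmetric]) (simp add: early_potential_def[abs_def])
  also have "\<dots> \<le> 3 * (real (card (pverts G)))\<^sup>2 * (l / (real (num_ones G X) + 1))"
    by (intro mult_left_mono *) auto
  finally show ?thesis by (simp add: early_potential_def field_simps)
qed

text \<open>
  Here the smaller of the two opinion classes has at least a third as many vertices as there are
  zeros, so the drift of the number of zeros is proportional to that number; and it is not empty,
  so the exponential summand loses a constant factor as well.
\<close>

lemma late_potential_contracts:
  assumes "card (pverts G) \<le> 4 * num_ones G X" and "\<not> superior_consensus G X"
    and "1 - (q0 - q1) * \<phi> / 3 \<le> l" "exp (- decay * \<phi>) \<le> l"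
  shows "step_expectation X late_potential \<le> l * late_potential X"
proof -
  let ?n = "real (card (pverts G))"
  define m where "m = min (real (num_ones G X)) (real (num_zeros X))"
  define C where "C = ?n * r powr (- ?n / 3)"
  have C: "0 \<le> C" by (simp add: C_def)
  have late_potential: "late_potential Y = real (num_zeros Y) + C * r ^ num_ones G Y" for Y
    using r_pos by (simp add: late_potential_def C_def powr_realpow[symmetric] powr_add[symmetric])
  have n: "real (num_ones G X) + real (num_zeros X) = ?n"
    using num_ones_plus_num_zeros[of X] by (simp flip: of_nat_add)
  have zeros: "1 \<le> num_zeros X" using assms(2) superior_consensus_iff by fastforce
  then have m: "1 \<le> m" "real (num_zeros X) / 3 \<le> m"
    using assms(1) n by (auto simp: m_def min_def)
  have "step_expectation X late_potential = (real (num_zeros X) - (q0 - q1) * cut_weight X) +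
      C * step_expectation X (\<lambda>Y. r ^ num_ones G Y)"
    by (simp add: late_potential[abs_def] step_expectation_add step_expectation_num_zeros)
  also have "\<dots> \<le> l * real (num_zeros X) + C * (r ^ num_ones G X * l)"
  proof (intro add_mono mult_left_mono C)
    have "(q0 - q1) * (\<phi> * (real (num_zeros X) / 3)) \<le> (q0 - q1) * (\<phi> * m)"
      using strict_bias expansion_pos m by (intro mult_left_mono) auto
    also have "\<dots> \<le> (q0 - q1) * cut_weight X"
      using strict_bias expansion[of X] by (intro mult_left_mono) (auto simp: m_def)
    finally have "real (num_zeros X) - (q0 - q1) * cut_weight X \<le> (1 - (q0 - q1) * \<phi> / 3) * real (num_zeros X)"
      by (simp add: algebra_simps)
    also have "\<dots> \<le> l * real (num_zeros X)" using assms(3) by (intro mult_right_mono) auto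
    finally show "real (num_zeros X) - (q0 - q1) * cut_weight X \<le> l * real (num_zeros X)" .
    have "decay * \<phi> * 1 \<le> decay * \<phi> * m"
      using decay_pos expansion_pos m by (intro mult_left_mono) auto
    then have "exp (- decay * \<phi> * m) \<le> exp (- decay * \<phi>)" by simp
    also have "\<dots> \<le> l" by (rule assms)
    finally have "r ^ num_ones G X * exp (- decay * \<phi> * m) \<le> r ^ num_ones G X * l"
      using r_pos by (intro mult_left_mono) auto
    then show "step_expectation X (\<lambda>Y. r ^ num_ones G Y) \<le> r ^ num_ones G X * l"
      using power_num_ones_decay[of X] by (simp add: m_def)
  qed
  also have "\<dots> = l * late_potential X" by (simp add: late_potential algebra_simps)
  finally show ?thesis .
qed

lemma early_le_late:
  assumes "4 * num_ones G X \<le> card (pverts G)"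
    and "3 * real (card (pverts G)) \<le> r powr (- real (card (pverts G)) / 12)"
  shows "early_potential X \<le> late_potential X"
proof -
  let ?n = "real (card (pverts G))"
  have "early_potential X \<le> 3 * ?n\<^sup>2 / 1"
    unfolding early_potential_def by (intro divide_left_mono) auto
  also have "\<dots> = ?n * (3 * ?n)" by (simp add: power2_eq_square)
  also have "\<dots> \<le> ?n * r powr (real (num_ones G X) - ?n / 3)"
  proof (intro mult_left_mono)
    have "4 * real (num_ones G X) \<le> ?n" using assms(1) by linarith
    then have "r powr (- ?n / 12) \<le> r powr (real (num_ones G X) - ?n / 3)"
      using r_pos r_less_1 by (intro powr_mono') auto
    then show "3 * ?n \<le> r powr (real (num_ones G X) - ?n / 3)" using assms(2) by simp
  qed simp
  finally show ?thesis by (simp add: late_potential_def)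
qed

lemma late_le_early:
  assumes "card (pverts G) \<le> 2 * num_ones G X" and "2 \<le> card (pverts G)"
  shows "late_potential X \<le> early_potential X"
proof -
  let ?n = "real (card (pverts G))"
  have le: "num_ones G X \<le> card (pverts G)" "num_zeros X \<le> card (pverts G)"
    using num_ones_plus_num_zeros[of X] by linarith+
  have "r powr (real (num_ones G X) - ?n / 3) \<le> r powr 0"
    using assms(1) r_pos r_less_1 by (intro powr_mono') auto
  then have "?n * r powr (real (num_ones G X) - ?n / 3) \<le> ?n * 1"
    using r_pos by (intro mult_left_mono) auto
  then have "late_potential X \<le> 2 * ?n" unfolding late_potential_def using le by linarith
  also have "\<dots> \<le> 3 * ?n\<^sup>2 / (?n + 1)"
  proof -
    have "2 * ?n * (?n + 1) \<le> 3 * ?n\<^sup>2"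
      using assms(2) mult_left_mono[of 2 ?n ?n] by (simp add: power2_eq_square algebra_simps)
    then show ?thesis by (simp add: pos_le_divide_eq)
  qed
  also have "\<dots> \<le> early_potential X"
    unfolding early_potential_def using le by (intro divide_left_mono) auto
  finally show ?thesis .
qed

text \<open>
  The potential is the minimum of the early and the late one. A minimum contracts at a state as
  soon as the piece that attains it does, and the two orderings above say that the early piece is
  attained below a quarter of the vertices and the late one above a half; in between both
  contract. The early piece contracts only from \<open>K\<close> ones on, so \<open>R\<close> is normalised to be at
  least 1 up to \<open>K\<close>.
\<close>

lemma failure_bound:
  assumes n: "2 \<le> card (pverts G)"
    and large: "3 * real (card (pverts G)) \<le> r powr (- real (card (pverts G)) / 12)"
    and l: "1 - (q0 - q1) * \<phi> / 3 \<le> l" "exp (- decay * \<phi>) \<le> l"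
    and growth: "\<And>a. K \<le> a \<Longrightarrow> 1 / ((1 + decay * \<phi> / (2 * ln (1 / r))) * real a + 1)
      + exp (- (decay * \<phi> / 2) * real a) \<le> l / (real a + 1)"
  shows "failure X T \<le> l ^ T * (3 * (real (card (pverts G)))\<^sup>2) + real T * (r ^ num_ones G X / r ^ K)"
proof -
  let ?n = "real (card (pverts G))"
  define H where "H X = min (early_potential X) (late_potential X)" for X
  define R where "R X = r ^ num_ones G X / r ^ K" for X
  have l_nonneg: "0 \<le> l" using l(2) exp_ge_zero order_trans by blast
  have "failure X T \<le> l ^ T * H X + real T * R X"
  proof (rule failure_le_potential[OF l_nonneg])
    fix X
    show "0 \<le> H X" by (simp add: H_def early_potential_def late_potential_def)
    show "0 \<le> R X" using r_pos by (simp add: R_def)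
    show "step_expectation X R \<le> R X"
      using power_num_ones_superharmonic[of X] r_pos
      by (simp add: R_def[abs_def] divide_right_mono)
    assume nc: "\<not> superior_consensus G X"
    have "1 \<le> num_zeros X" using nc superior_consensus_iff by fastforce
    then have "1 \<le> late_potential X" unfolding late_potential_def by (intro add_increasing2) auto
    moreover have "1 \<le> early_potential X"
    proof -
      have "num_ones G X \<le> card (pverts G)" using num_ones_plus_num_zeros[of X] by linarith
      moreover have "?n + 1 \<le> 3 * ?n\<^sup>2"
      proof -
        have "1 * ?n \<le> ?n * ?n" using n by (intro mult_right_mono) auto
        then show ?thesis using n unfolding power2_eq_square by linarith
      qed
      ultimately have "real (num_ones G X) + 1 \<le> 3 * ?n\<^sup>2" by linarith
      then show ?thesis by (simp add: early_potential_def pos_le_divide_eq)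
    qed
    ultimately show "1 \<le> H X" by (simp add: H_def)
    assume "R X < 1"
    then have "r ^ num_ones G X < r ^ K" using r_pos by (simp add: R_def)
    then have K: "K \<le> num_ones G X"
      using power_decreasing[of "num_ones G X" K r] r_pos r_less_1 by force
    have E: "step_expectation X H \<le> l * early_potential X" if "2 * num_ones G X \<le> card (pverts G)"
    proof -
      have "step_expectation X H \<le> step_expectation X early_potential"
        by (rule step_expectation_mono) (simp add: H_def)
      then show ?thesis using early_potential_contracts[OF that growth[OF K]] by simp
    qed
    have L: "step_expectation X H \<le> l * late_potential X" if "card (pverts G) \<le> 4 * num_ones G X"
    proof -
      have "step_expectation X H \<le> step_expectation X late_potential"
        by (rule step_expectation_mono) (simp add: H_def)
      then show ?thesis using late_potential_contracts[OF that nc l] by simp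
    qed
    consider "4 * num_ones G X < card (pverts G)"
      | "card (pverts G) \<le> 4 * num_ones G X" "2 * num_ones G X \<le> card (pverts G)"
      | "card (pverts G) < 2 * num_ones G X" by linarith
    then show "step_expectation X H \<le> l * H X"
    proof cases
      case 1
      then show ?thesis using E early_le_late[of X] large by (simp add: H_def)
    next
      case 2
      then show ?thesis using E L by (simp add: H_def min_def)
    next
      case 3
      then show ?thesis using L late_le_early[of X] n by (simp add: H_def)
    qed
  qed
  also have "\<dots> \<le> l ^ T * (3 * ?n\<^sup>2) + real T * R X"
  proof (intro add_mono mult_left_mono order_refl)
    have "early_potential X \<le> 3 * ?n\<^sup>2 / 1" unfolding early_potential_def by (intro divide_left_mono) auto
    then show "H X \<le> 3 * ?n\<^sup>2" by (simp add: H_def)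
  qed (use l_nonneg in auto)
  finally show ?thesis by (simp add: R_def)
qed

end

section \<open>Consensus on expander families\<close>

text \<open>
  The rate \<open>l\<close> and the threshold \<open>K\<close> serve all graphs at once, which allows the graph to
  vary with its size.
\<close>

lemma voter_failure_uniform_bound:
  fixes q0 q1 \<phi> r :: real
  assumes "0 \<le> q1" "q1 < q0 * r" "q0 \<le> 1" "0 < \<phi>" "0 < r" "r < 1"
  obtains l K where "0 < l" "l < 1"
    and "\<And>(G :: 'a pair_pre_digraph) d X T.
      regular_graph d G \<Longrightarrow> 2 \<le> card (pverts G) \<Longrightarrow> \<phi> \<le> conductance d G \<Longrightarrow>
      3 * real (card (pverts G)) \<le> r powr (- real (card (pverts G)) / 12) \<Longrightarrow>
      1 - measure_pmf.prob (voter_path q0 q1 G X T) {path. \<exists>Y \<in> set path. superior_consensus G Y}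
        \<le> l ^ T * (3 * (real (card (pverts G)))\<^sup>2) + real T * (r ^ num_ones G X / r ^ K)"
proof -
  define \<kappa> where "\<kappa> = (1 - r) * (q0 - q1 / r)"
  have \<kappa>: "0 < \<kappa>"
    unfolding \<kappa>_def using assms by (intro mult_pos_pos) (simp_all add: field_simps)
  have "0 < q0 * r" using assms by linarith
  then have "0 < q0" using \<open>0 < r\<close> by (simp add: zero_less_mult_iff)
  then have "q0 * r < q0 * 1" using \<open>r < 1\<close> by (intro mult_strict_left_mono) auto
  then have q: "q1 < q0" using assms by linarith
  have "0 < \<kappa> * \<phi> / (2 * ln (1 / r))" "0 < \<kappa> * \<phi> / 2" using \<kappa> assms by auto
  then obtain l1 K where l1: "0 < l1" "l1 < 1"
    and K: "\<And>a. K \<le> a \<Longrightarrow> 1 / ((1 + \<kappa> * \<phi> / (2 * ln (1 / r))) * real a + 1)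
      + exp (- (\<kappa> * \<phi> / 2) * real a) \<le> l1 / (real a + 1)"
    using reciprocal_gain_absorbs_exponential by (metis greaterThanLessThan_iff)
  define l where "l = max l1 (max (1 - (q0 - q1) * \<phi> / 3) (exp (- \<kappa> * \<phi>)))"
  show ?thesis
  proof (rule that[of l K])
    show "0 < l" "l < 1" using l1 \<kappa> \<open>0 < \<phi>\<close> q by (auto simp: l_def)
    fix G :: "'a pair_pre_digraph" and d X T
    assume reg: "regular_graph d G" and n: "2 \<le> card (pverts G)" and cond: "\<phi> \<le> conductance d G"
      and large: "3 * real (card (pverts G)) \<le> r powr (- real (card (pverts G)) / 12)"
    have d: "0 < d" using degree_pos_of_conductance_pos[OF reg n] cond \<open>0 < \<phi>\<close> by linarith
    interpret biased_voter q0 q1 G d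
      using reg d assms q by unfold_locales auto
    interpret expanding_voter q0 q1 G d \<phi> r
    proof
      fix X :: "'a \<Rightarrow> bool"
      have "pverts G - {u \<in> pverts G. X u} = {u \<in> pverts G. \<not> X u}" by auto
      then show "\<phi> * min (real (num_ones G X)) (real (num_zeros X)) \<le> cut_weight X"
        using expansion_of_cuts[OF reg n \<open>0 < \<phi>\<close> cond, of "{u \<in> pverts G. X u}"]
        by (simp add: cut_weight_def num_ones_def)
    qed (use assms in auto)
    have "decay = \<kappa>" by (simp add: decay_def \<kappa>_def)
    have "failure X T \<le> l ^ T * (3 * (real (card (pverts G)))\<^sup>2) + real T * (r ^ num_ones G X / r ^ K)"
    proof (rule failure_bound[OF n large])
      show "1 - (q0 - q1) * \<phi> / 3 \<le> l" "exp (- decay * \<phi>) \<le> l"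
        by (auto simp: l_def \<open>decay = \<kappa>\<close>)
      fix a assume "K \<le> a"
      have "l1 / (real a + 1) \<le> l / (real a + 1)"
        by (intro divide_right_mono) (auto simp: l_def)
      then show "1 / ((1 + decay * \<phi> / (2 * ln (1 / r))) * real a + 1)
          + exp (- (decay * \<phi> / 2) * real a) \<le> l / (real a + 1)"
        using K[OF \<open>K \<le> a\<close>] by (simp add: \<open>decay = \<kappa>\<close>)
    qed
    then show "1 - measure_pmf.prob (voter_path q0 q1 G X T) {path. \<exists>Y \<in> set path. superior_consensus G Y}
        \<le> l ^ T * (3 * (real (card (pverts G)))\<^sup>2) + real T * (r ^ num_ones G X / r ^ K)"
      by (simp add: failure_eq_1_minus)
  qed
qed

theorem theorem1:
  fixes q0 q1 \<phi> :: real
  assumes "0 \<le> q1" and "q1 < q0" and "q0 \<le> 1" and "0 < \<phi>"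
  shows "\<exists>\<gamma>\<in>{0<..<1}. \<forall>c>0. \<exists>\<gamma>'\<in>{0<..\<gamma>}. (1 \<le> c \<longrightarrow> \<gamma>' = \<gamma>) \<and>
    (\<forall>(G :: nat \<Rightarrow> nat pair_pre_digraph) (X0 :: nat \<Rightarrow> nat \<Rightarrow> bool).
      expander_family \<phi> G \<longrightarrow>
      (\<forall>\<^sub>F n in sequentially. c * ln (real n) \<le> real (num_ones (G n) (X0 n))) \<longrightarrow>
      (\<exists>(T1 :: nat \<Rightarrow> nat) (T2 :: nat \<Rightarrow> nat) (\<epsilon> :: nat \<Rightarrow> real).
        (\<lambda>n. real (T1 n)) \<in> O(\<lambda>n. ln (real n) / ln (1 + (q0 - q1) / 2 * \<phi>)) \<and>
        (\<lambda>n. real (T2 n)) \<in> O(\<lambda>n. ln (real n) / ln (1 / (1 - (q0 - q1) * \<phi>))) \<and>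
        \<epsilon> \<in> O(\<lambda>n. ln (real n) / real n powr \<gamma>') \<and>
        (\<forall>n. 1 - \<epsilon> n \<le>
          measure_pmf.prob (voter_path q0 q1 (G n) (X0 n) (T1 n + T2 n))
            {path. \<exists>X \<in> set path. superior_consensus (G n) X})))"
proof -
  define m where "m = max (q1 / q0) (exp (- 1))"
  have m: "q1 / q0 \<le> m" "exp (- 1) \<le> m" "0 < m" "m < 1"
    using assms by (auto simp: m_def less_max_iff_disj)
  (* The bound r > exp (- 1) makes \<gamma> = ln (1 / r) smaller than 1. *)
  define r where "r = (1 + m) / 2"
  have mid: "x < (1 + m) / 2" if "x \<le> m" for x
    using that m(4) by (simp add: field_simps)
  have r: "0 < r" "r < 1" "exp (- 1) < r" "q1 / q0 < r"
    using m(3,4) mid[OF m(1)] mid[OF m(2)] by (simp_all add: r_def)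
  then have bias: "q1 < q0 * r" using assms by (simp add: field_simps)
  define \<gamma> where "\<gamma> = ln (1 / r)"
  have "- 1 < ln r" using r ln_less_cancel_iff[of "exp (- 1)" r] by simp
  then have \<gamma>: "0 < \<gamma>" "\<gamma> < 1" using r by (auto simp: \<gamma>_def ln_div)
  obtain l K where l: "0 < l" "l < 1" and bound: "\<And>(G :: nat pair_pre_digraph) d X T.
      regular_graph d G \<Longrightarrow> 2 \<le> card (pverts G) \<Longrightarrow> \<phi> \<le> conductance d G \<Longrightarrow>
      3 * real (card (pverts G)) \<le> r powr (- real (card (pverts G)) / 12) \<Longrightarrow>
      1 - measure_pmf.prob (voter_path q0 q1 G X T) {path. \<exists>Y \<in> set path. superior_consensus G Y}
        \<le> l ^ T * (3 * (real (card (pverts G)))\<^sup>2) + real T * (r ^ num_ones G X / r ^ K)"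
    by (rule voter_failure_uniform_bound[OF assms(1) bias assms(3,4) r(1,2), where ?'a = nat])
      (rule that)
  have l_log: "0 < ln (1 / l)" using l by simp
  (* After T n steps the contraction factor is at most n^(-3), against an initial potential of at
     most 3 * n^2. *)
  define T where "T n = nat \<lceil>3 * ln (real n) / ln (1 / l)\<rceil>" for n :: nat
  define C where "C = 3 / ln (1 / l) + 1"
  have C: "0 < C" using l_log by (simp add: C_def add_pos_pos)
  have ln_ge_1: "1 \<le> ln (real n)" if "3 \<le> n" for n :: nat
    using that exp_le by (subst ln_ge_iff) auto
  have T_le: "real (T n) \<le> C * ln (real n)" if "3 \<le> n" for n
  proof -
    have "0 \<le> 3 * ln (real n) / ln (1 / l)" using ln_ge_1[OF that] l_log by simp
    then have "real (T n) \<le> 3 * ln (real n) / ln (1 / l) + 1"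
      unfolding T_def by linarith
    then show ?thesis using ln_ge_1[OF that] by (simp add: C_def algebra_simps)
  qed
  have T_ge: "l ^ T n \<le> real n powr (- 3)" if "3 \<le> n" for n
  proof -
    have "3 * ln (real n) / ln (1 / l) \<le> real (T n)" unfolding T_def by linarith
    then have "3 * ln (real n) \<le> real (T n) * ln (1 / l)" using l_log by (simp add: pos_divide_le_eq)
    then have "real (T n) * ln l \<le> - 3 * ln (real n)" using l by (simp add: ln_div)
    then have "exp (real (T n) * ln l) \<le> exp (- 3 * ln (real n))" by (simp only: exp_le_cancel_iff)
    then show ?thesis using that l by (simp add: powr_def exp_of_nat_mult)
  qed
  have large: "\<forall>\<^sub>F n in sequentially. 3 * real n \<le> r powr (- real n / 12)"
  proof -
    have "\<forall>\<^sub>F n in sequentially. 3 * real n \<le> exp (\<gamma> / 12 * real n)"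
      using \<gamma>(1) by real_asymp
    moreover have "exp (\<gamma> / 12 * real n) = r powr (- real n / 12)" for n
      using r by (simp add: powr_def \<gamma>_def ln_div)
    ultimately show ?thesis by simp
  qed
  show ?thesis
  proof (rule bexI[of _ \<gamma>], intro allI impI)
    fix c :: real
    assume c: "0 < c"
    define \<gamma>' where "\<gamma>' = min c 1 * \<gamma>"
    have \<gamma>': "0 < \<gamma>'" "\<gamma>' \<le> \<gamma>" using c \<gamma> mult_right_mono[of "min c 1" 1 \<gamma>] by (auto simp: \<gamma>'_def)
    show "\<exists>\<gamma>'\<in>{0<..\<gamma>}. (1 \<le> c \<longrightarrow> \<gamma>' = \<gamma>) \<and>
    (\<forall>(G :: nat \<Rightarrow> nat pair_pre_digraph) (X0 :: nat \<Rightarrow> nat \<Rightarrow> bool).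
      expander_family \<phi> G \<longrightarrow>
      (\<forall>\<^sub>F n in sequentially. c * ln (real n) \<le> real (num_ones (G n) (X0 n))) \<longrightarrow>
      (\<exists>(T1 :: nat \<Rightarrow> nat) (T2 :: nat \<Rightarrow> nat) (\<epsilon> :: nat \<Rightarrow> real).
        (\<lambda>n. real (T1 n)) \<in> O(\<lambda>n. ln (real n) / ln (1 + (q0 - q1) / 2 * \<phi>)) \<and>
        (\<lambda>n. real (T2 n)) \<in> O(\<lambda>n. ln (real n) / ln (1 / (1 - (q0 - q1) * \<phi>))) \<and>
        \<epsilon> \<in> O(\<lambda>n. ln (real n) / real n powr \<gamma>') \<and>
        (\<forall>n. 1 - \<epsilon> n \<le>
          measure_pmf.prob (voter_path q0 q1 (G n) (X0 n) (T1 n + T2 n))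
            {path. \<exists>X \<in> set path. superior_consensus (G n) X})))"
    proof (rule bexI[of _ \<gamma>'], intro conjI allI impI)
      show "\<gamma>' = \<gamma>" if "1 \<le> c" using that by (simp add: \<gamma>'_def)
      show "\<gamma>' \<in> {0<..\<gamma>}" using \<gamma>' by simp
      fix G :: "nat \<Rightarrow> nat pair_pre_digraph" and X0 :: "nat \<Rightarrow> nat \<Rightarrow> bool"
      assume "expander_family \<phi> G"
        and start: "\<forall>\<^sub>F n in sequentially. c * ln (real n) \<le> real (num_ones (G n) (X0 n))"
      then obtain d where reg: "\<And>n. regular_graph (d n) (G n)" and card: "\<And>n. card (pverts (G n)) = n"
        and cond: "\<And>n. 2 \<le> n \<Longrightarrow> \<phi> \<le> conductance (d n) (G n)"
        unfolding expander_family_def by blast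
      (* The error is the exact failure probability; only its order of magnitude needs an argument. *)
      define \<epsilon> where "\<epsilon> n = 1 - measure_pmf.prob (voter_path q0 q1 (G n) (X0 n) (T n))
        {path. \<exists>X \<in> set path. superior_consensus (G n) X}" for n
      have \<epsilon>_nonneg: "0 \<le> \<epsilon> n" for n by (simp add: \<epsilon>_def)
      have "\<forall>\<^sub>F n in sequentially. norm (\<epsilon> n) \<le> (3 + C / r ^ K) * norm (ln (real n) / real n powr \<gamma>')"
        using large start eventually_ge_at_top[of 3]
      proof eventually_elim
        case (elim n)
        define L where "L = ln (real n) / real n powr \<gamma>'"
        have n: "0 < real n" and ln1: "1 \<le> ln (real n)" using elim(3) ln_ge_1 by auto
        have "\<epsilon> n \<le> l ^ T n * (3 * (real n)\<^sup>2) + real (T n) * (r ^ num_ones (G n) (X0 n) / r ^ K)"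
          unfolding \<epsilon>_def using bound[OF reg _ cond, of n "X0 n" "T n"] elim by (simp add: card)
        also have "\<dots> \<le> 3 * L + C * ln (real n) * (real n powr (- \<gamma>') / r ^ K)"
        proof -
          have "l ^ T n * (3 * (real n)\<^sup>2) \<le> real n powr (- 3) * (3 * (real n)\<^sup>2)"
            using T_ge[OF elim(3)] by (intro mult_right_mono) auto
          also have "\<dots> = 3 * real n powr (- 1)"
            using n by (simp add: powr_minus field_simps power2_eq_square power3_eq_cube)
          also have "\<dots> \<le> 3 * real n powr (- \<gamma>')"
            using elim(3) \<gamma> \<gamma>' by (intro mult_left_mono powr_mono) auto
          also have "\<dots> \<le> 3 * L"
            using ln1 by (simp add: L_def powr_minus_divide divide_right_mono)
          finally have contracted: "l ^ T n * (3 * (real n)\<^sup>2) \<le> 3 * L" .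
          (* For c > 1 the start is weakened to ln n ones, which caps the exponent at \<gamma>. *)
          have "min c 1 * ln (real n) \<le> c * ln (real n)" using ln1 by (intro mult_right_mono) auto
          also note elim(2)
          finally have A: "min c 1 * ln (real n) \<le> real (num_ones (G n) (X0 n))" .
          have "r ^ num_ones (G n) (X0 n) = r powr real (num_ones (G n) (X0 n))"
            using r by (simp add: powr_realpow)
          also have "\<dots> \<le> r powr (min c 1 * ln (real n))" using A r by (intro powr_mono') auto
          also have "\<dots> = real n powr (- \<gamma>')"
            using n r by (simp add: powr_def \<gamma>'_def \<gamma>_def ln_div)
          finally have fallback: "r ^ num_ones (G n) (X0 n) \<le> real n powr (- \<gamma>')" .
          show ?thesis
            by (intro add_mono contracted mult_mono divide_right_mono fallback)
              (use T_le[OF elim(3)] r C ln1 in auto)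
        qed
        also have "\<dots> = (3 + C / r ^ K) * L"
          by (simp add: L_def powr_minus_divide algebra_simps)
        also have "\<dots> = (3 + C / r ^ K) * norm L" using ln1 by (simp add: L_def)
        finally show ?case using \<epsilon>_nonneg by (simp add: L_def)
      qed
      then have \<epsilon>_O: "\<epsilon> \<in> O(\<lambda>n. ln (real n) / real n powr \<gamma>')" by (rule bigoI)
      have D: "0 < ln (1 + (q0 - q1) / 2 * \<phi>)"
        using assms by (intro ln_gt_zero) (simp add: zero_less_mult_iff)
      have "\<forall>\<^sub>F n in sequentially. norm (real (T n)) \<le>
          (C * ln (1 + (q0 - q1) / 2 * \<phi>)) * norm (ln (real n) / ln (1 + (q0 - q1) / 2 * \<phi>))"
        using eventually_ge_at_top[of 3]
        by eventually_elim (use D T_le ln_ge_1 in \<open>auto simp: field_simps\<close>)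
      then have T_O: "(\<lambda>n. real (T n)) \<in> O(\<lambda>n. ln (real n) / ln (1 + (q0 - q1) / 2 * \<phi>))"
        by (rule bigoI)
      show "\<exists>(T1 :: nat \<Rightarrow> nat) (T2 :: nat \<Rightarrow> nat) (\<epsilon> :: nat \<Rightarrow> real).
        (\<lambda>n. real (T1 n)) \<in> O(\<lambda>n. ln (real n) / ln (1 + (q0 - q1) / 2 * \<phi>)) \<and>
        (\<lambda>n. real (T2 n)) \<in> O(\<lambda>n. ln (real n) / ln (1 / (1 - (q0 - q1) * \<phi>))) \<and>
        \<epsilon> \<in> O(\<lambda>n. ln (real n) / real n powr \<gamma>') \<and>
        (\<forall>n. 1 - \<epsilon> n \<le>
          measure_pmf.prob (voter_path q0 q1 (G n) (X0 n) (T1 n + T2 n))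
            {path. \<exists>X \<in> set path. superior_consensus (G n) X})"
        (* T already covers both phases, so the second summand of the running time is 0. *)
        by (intro exI[of _ T] exI[of _ "\<lambda>_. 0"] exI[of _ \<epsilon>]) (use T_O \<epsilon>_O in \<open>simp add: \<epsilon>_def\<close>)
    qed
  qed (use \<gamma> in simp)
qed

end
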